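(* Let $S_1,\dots,S_q$ be a basis of a linear subspace $\mathcal S\subseteq\mathbb{R}^{m\times n}$, let $A=\sum_{i=1}^qa_iS_i\in\mathcal S$ with $a=[a_1,\dots,a_q]^\top$, and let $b\in\mathbb{R}^m$ be such that the genericity condition $\widetilde\sigma_n>\sigma_{n+1}$ holds. Let $x$ be the unique TLS solution, $r=b-Ax$, $P=A^\top A-\sigma_{n+1}^2I_n$, and $L\in\mathbb{R}^{k\times n}$ with $k\le n$. Put $\mathcal N_s=P^{-1}V$, $V=[v_1,\dots,v_q]$ with $v_i=S_i^\top r-\left[A^\top+\frac{2xr^\top}{1+x^\top x}\right]S_ix$, and $\mathcal H=P^{-1}\left[A^\top+\frac{2xr^\top}{1+x^\top x}\right]$. When the infinity norm is chosen on the solution space $\mathbb{R}^k$, the structured condition number of $\Psi_s(a,b)=Lx$ is $$\kappa_{s,\infty}=\left\|\,|L\mathcal N_s||a|+|L\mathcal H||b|\,\right\|_\infty,$$ and (for $Lx\ne0$) the corresponding relative structured mixed condition number is $$\kappa_{s,\infty}^{\mathrm{rel}}=\frac{\left\|\,|L\mathcal N_s||a|+|L\mathcal H||b|\,\right\|_\infty}{\|Lx\|_\infty} =\frac{\left\|\sum_{i=1}^q|a_i|\left|LP^{-1}\left(\left[A^\top+\frac{2xr^\top}{1+x^\top x}\right]S_ix-S_i^\top r\right)\right|+\left|LP^{-1}\left[A^\top+\frac{2xr^\top}{1+x^\top x}\right]\right||b|\right\|_\infty}{\|Lx\|_\infty}.$$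
   Context: Let $m>n$. The total least squares (TLS) problem for $A\in\mathbb{R}^{m\times n}$, $b\in\mathbb{R}^m$ is to minimize $\|[A,b]-[\widehat A,\widehat b]\|_F$ over $[\widehat A,\widehat b]\in\mathbb{R}^{m\times(n+1)}$ with $\widehat b$ in the range of $\widehat A$; any $x$ with $\widehat A x=\widehat b$ for a minimizer is a TLS solution. Let $\widetilde\sigma_n$ be the smallest singular value of $A$ and $\sigma_{n+1}$ the smallest singular value of $[A,b]$. Under the genericity condition $\widetilde\sigma_n>\sigma_{n+1}$ there is a unique TLS solution $x$; it satisfies $(A^\top A-\sigma_{n+1}^2I_n)x=A^\top b$. $\Psi_s(a,b)=Lx$, where $x$ is the TLS solution for $A=\sum_ia_iS_i$ and $b$; it is defined on those $(a,b)\in\mathbb{R}^q\times\mathbb{R}^m$ satisfying the genericity condition. It is Fréchet differentiable there with derivative $\mathsf d\Psi_s(a,b)\cdot(\mathsf da,\mathsf db)=LP^{-1}V\,\mathsf da+LP^{-1}\left[A^\top+\frac{2xr^\top}{1+x^\top x}\right]\mathsf db$. Componentwise norm on the data space: $\|(\mathsf da,\mathsf db)\|_c=\min\{\omega\ge0:|\mathsf da|\le\omega|a|,\ |\mathsf db|\le\omega|b|\}$ (entrywise), and $=\infty$ if no such $\omega$ exists. For a norm $\|\cdot\|_{\mathcal V}$ on $\mathbb{R}^k$ the structured condition number is $\kappa_s=\max_{\|(\mathsf da,\mathsf db)\|_c=1}\|\mathsf d\Psi_s(a,b)\cdot(\mathsf da,\mathsf db)\|_{\mathcal V}$ and the relative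 one is $\kappa_s^{\mathrm{rel}}=\kappa_s\|(a,b)\|_c/\|Lx\|_{\mathcal V}=\kappa_s/\|Lx\|_{\mathcal V}$; the subscript $\infty$ indicates $\|\cdot\|_{\mathcal V}=\|\cdot\|_\infty$. $|\cdot|$ is the entrywise absolute value. *)

theory Defs
  imports "HOL-Analysis.Analysis"
begin

text \<open>
  Conventions. An \<open>m \<times> n\<close> matrix is an element of \<open>real^'n^'m\<close>. The library norm on this type is
  the Frobenius norm, and \<open>\<bar>_\<bar>\<close> and \<open>\<le>\<close> act entrywise on \<open>real^'n\<close> and on \<open>real^'n^'m\<close>.
\<close>

definition outer :: "real^'n \<Rightarrow> real^'m \<Rightarrow> real^'m^'n" where
  "outer x y = (\<chi> i j. x $ i * y $ j)"

text \<open>The augmented matrix \<open>[A, b]\<close>; the index type \<open>'n + 1\<close> has \<open>CARD('n) + 1\<close> elements.\<close>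

definition augment :: "real^'n^'m \<Rightarrow> real^'m \<Rightarrow> real^('n + 1)^'m" where
  "augment A b = (\<chi> i j. case j of Inl j' \<Rightarrow> A $ i $ j' | Inr _ \<Rightarrow> b $ i)"

text \<open>
  The square roots of the eigenvalues of \<open>A\<^sup>T A\<close>. These are the singular values of \<open>A\<close> when \<open>A\<close> has
  at least as many rows as columns, which is the only case used; for a wide matrix
  the set would also contain spurious zeros.
\<close>

definition singular_values :: "real^'n^'m \<Rightarrow> real set" where
  "singular_values A =
     {s. s \<ge> 0 \<and> (\<exists>v. v \<noteq> 0 \<and> (transpose A ** A) *v v = s\<^sup>2 *\<^sub>R v)}"

definition smallest_singular_value :: "real^'n^'m \<Rightarrow> real" where
  "smallest_singular_value A = Min (singular_values A)"

definition tls_generic :: "real^'n^'m \<Rightarrow> real^'m \<Rightarrow> bool" where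
  "tls_generic A b \<longleftrightarrow> smallest_singular_value A > smallest_singular_value (augment A b)"

definition tls_minimizer ::
    "real^'n^'m \<Rightarrow> real^'m \<Rightarrow> real^'n^'m \<Rightarrow> real^'m \<Rightarrow> bool" where
  "tls_minimizer A b A' b' \<longleftrightarrow>
     b' \<in> range (\<lambda>y. A' *v y) \<and>
     (\<forall>A'' b''. b'' \<in> range (\<lambda>y. A'' *v y) \<longrightarrow>
        norm (augment A b - augment A' b') \<le> norm (augment A b - augment A'' b''))"

definition is_tls_solution :: "real^'n^'m \<Rightarrow> real^'m \<Rightarrow> real^'n \<Rightarrow> bool" where
  "is_tls_solution A b x \<longleftrightarrow> (\<exists>A' b'. tls_minimizer A b A' b' \<and> A' *v x = b')"

definition tls_solution :: "real^'n^'m \<Rightarrow> real^'m \<Rightarrow> real^'n" where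
  "tls_solution A b = (THE x. is_tls_solution A b x)"

definition struct_matrix :: "('q \<Rightarrow> real^'n^'m) \<Rightarrow> real^'q \<Rightarrow> real^'n^'m" where
  "struct_matrix S a = (\<Sum>i\<in>UNIV. a $ i *\<^sub>R S i)"

text \<open>
  The solution map \<open>\<Psi>\<^sub>s\<close>, extended by arbitrary values outside the set of generic data. That set is
  open, so the extension does not influence the derivative at a generic point.
\<close>

definition tls_map ::
    "('q \<Rightarrow> real^'n^'m) \<Rightarrow> real^'n^'k \<Rightarrow> (real^'q) \<times> (real^'m) \<Rightarrow> real^'k" where
  "tls_map S L = (\<lambda>(a, b). L *v tls_solution (struct_matrix S a) b)"

text \<open>
  The componentwise norm of the perturbation \<open>(da, db)\<close> relative to the data \<open>(a, b)\<close>. The set of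
  admissible \<open>\<omega>\<close> is closed and bounded below, so it has a least element whenever it is nonempty.
\<close>

definition componentwise_norm ::
    "(real^'q) \<times> (real^'m) \<Rightarrow> (real^'q) \<times> (real^'m) \<Rightarrow> ereal" where
  "componentwise_norm = (\<lambda>(a, b) (da, db).
     if \<exists>\<omega>\<ge>0. \<bar>da\<bar> \<le> \<omega> *\<^sub>R \<bar>a\<bar> \<and> \<bar>db\<bar> \<le> \<omega> *\<^sub>R \<bar>b\<bar>
     then ereal (LEAST \<omega>. \<omega> \<ge> 0 \<and> \<bar>da\<bar> \<le> \<omega> *\<^sub>R \<bar>a\<bar> \<and> \<bar>db\<bar> \<le> \<omega> *\<^sub>R \<bar>b\<bar>)
     else \<infinity>)"

text \<open>
  The structured condition number with respect to a norm \<open>N\<close> on the solution space; \<open>GREATEST\<close>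
  is the maximum over the perturbations of componentwise norm 1 and is meaningful only if it is attained.
\<close>

definition structured_cond ::
    "(real^'k \<Rightarrow> real) \<Rightarrow> ('q \<Rightarrow> real^'n^'m) \<Rightarrow> real^'n^'k \<Rightarrow> (real^'q) \<times> (real^'m) \<Rightarrow> real" where
  "structured_cond N S L d =
     (GREATEST c. \<exists>h. componentwise_norm d h = 1 \<and>
        c = N (frechet_derivative (tls_map S L) (at d) h))"

definition structured_cond_rel ::
    "(real^'k \<Rightarrow> real) \<Rightarrow> ('q \<Rightarrow> real^'n^'m) \<Rightarrow> real^'n^'k \<Rightarrow> (real^'q) \<times> (real^'m) \<Rightarrow> real" where
  "structured_cond_rel N S L d =
     structured_cond N S L d * real_of_ereal (componentwise_norm d d) / N (tls_map S L d)"

end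

theory Submission
  imports Defs
begin

text \<open>
  Write \<open>C = [A, b]\<close>, \<open>\<sigma>\<close> for the smallest singular value of \<open>C\<close>, and \<open>r = b - A x\<close>.

  The first point is to replace the constrained minimization by an unconstrained one. A correction
  of \<open>C\<close> to \<open>[A', b']\<close> is compatible with \<open>x\<close>, that is \<open>A' x = b'\<close>, exactly if it kills the vector
  \<open>z = (x, -1)\<close>; such a correction costs at least \<open>\<parallel>C z\<parallel> / \<parallel>z\<parallel>\<close>, and the rank-one correction
  \<open>C z z\<^sup>T / \<parallel>z\<parallel>\<^sup>2\<close> costs exactly this. So the TLS solutions are the \<open>x\<close> for which \<open>(x, -1)\<close> minimizes
  the stretch \<open>\<parallel>C z\<parallel> / \<parallel>z\<parallel>\<close>, provided that some minimizing vector has nonzero last entry; genericity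
  guarantees this and uniqueness, because a minimizer of the form \<open>(w, 0)\<close> would give
  \<open>\<parallel>A w\<parallel> \<le> \<sigma> \<parallel>w\<parallel>\<close> (\<open>tls_solution_minimal\<close>).

  The minimum being a critical point gives \<open>A\<^sup>T r + \<sigma>\<^sup>2 x = 0\<close> with \<open>\<sigma>\<^sup>2 = \<parallel>r\<parallel>\<^sup>2 / (1 + x\<^sup>T x)\<close>. Inserting
  the second equation into the first turns it into an equation \<open>G (A, b, x) = 0\<close> with \<open>G\<close> smooth
  and free of singular values (\<open>tls_equation\<close>). The quotient \<open>\<parallel>r\<parallel>\<^sup>2 / (1 + x\<^sup>T x)\<close> is stationary in \<open>x\<close>
  at the solution, hence the partial derivative of \<open>G\<close> in \<open>x\<close> is just \<open>- P\<close>, which is invertible by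
  genericity. Implicit differentiation (\<open>has_derivative_implicit\<close>) then yields the derivative
  \<open>(dA, db) \<mapsto> P\<^sup>-\<^sup>1 (dA\<^sup>T r + B (db - dA x))\<close>. The only analytic input is the continuity of the
  solution map; it follows from the continuity of singular values and from the error bound
  \<open>tls_error_bound\<close>, in which the gap between the two singular values is the coercivity constant.

  Along the structured data the derivative is \<open>(da, db) \<mapsto> L N\<^sub>s da + L H db\<close>. Componentwise norm 1
  forces \<open>\<bar>da\<bar> \<le> \<bar>a\<bar>\<close> and \<open>\<bar>db\<bar> \<le> \<bar>b\<bar>\<close>, so every entry of the image is bounded by the corresponding
  entry of \<open>\<bar>L N\<^sub>s\<bar> \<bar>a\<bar> + \<bar>L H\<bar> \<bar>b\<bar>\<close>; adapting the signs of \<open>da\<close> and \<open>db\<close> to the row in which this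
  vector is largest attains the bound (\<open>greatest_infnorm_componentwise\<close>).
\<close>

section \<open>The smallest singular value as the minimal stretch\<close>

text \<open>
  As a simplification rule, \<open>transpose_matrix_vector\<close> would turn \<open>A\<^sup>T y\<close> into \<open>y v* A\<close>, on which the
  adjoint rule below no longer matches.
\<close>

declare transpose_matrix_vector [simp del]

lemma inner_transpose_matrix_vector:
  fixes A :: "real^'n^'m"
  shows "(transpose A *v y) \<bullet> w = y \<bullet> (A *v w)"
  by (simp add: dot_lmul_matrix transpose_matrix_vector)

lemma norm_matrix_vector_le:
  fixes A :: "real^'n^'m"
  shows "norm (A *v x) \<le> norm A * norm x"
proof -
  have "norm (A *v x) \<le> L2_set (\<lambda>i. norm (A $ i) * norm x) UNIV"
    unfolding norm_vec_def[of "A *v x"]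
    by (intro L2_set_mono) (auto simp: matrix_vector_mul_component Cauchy_Schwarz_ineq2)
  also have "\<dots> = norm A * norm x"
    unfolding norm_vec_def[of A] by (simp add: L2_set_left_distrib)
  finally show ?thesis .
qed

text \<open>
  The quadratic form \<open>\<parallel>M v\<parallel>\<^sup>2 - s\<^sup>2 \<parallel>v\<parallel>\<^sup>2\<close> is positive semidefinite and vanishes at \<open>u\<close>; a zero of a
  semidefinite form lies in the radical of the associated bilinear form. This one fact gives both the
  eigenvector equation for \<open>A\<^sup>T A\<close> and the stationarity equations of the TLS problem.
\<close>

lemma inner_eq_if_minimal_stretch:
  fixes M :: "real^'n^'m"
  assumes lower: "\<And>v. s * norm v \<le> norm (M *v v)" and "0 \<le> s"
    and min: "norm (M *v u) = s * norm u"
  shows "(M *v u) \<bullet> (M *v w) = s\<^sup>2 * (u \<bullet> w)"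
proof -
  have nonneg: "0 \<le> (norm (M *v v))\<^sup>2 - s\<^sup>2 * (norm v)\<^sup>2" for v
    using power_mono[OF lower[of v], of 2] \<open>0 \<le> s\<close> by (simp add: power_mult_distrib)
  define c where "c = (M *v u) \<bullet> (M *v w) - s\<^sup>2 * (u \<bullet> w)"
  define e where "e = (norm (M *v w))\<^sup>2 - s\<^sup>2 * (norm w)\<^sup>2"
  have e: "0 \<le> e" unfolding e_def by (rule nonneg)
  have min2: "(M *v u) \<bullet> (M *v u) = s\<^sup>2 * (u \<bullet> u)"
    using min by (simp add: power_mult_distrib flip: power2_norm_eq_inner)
  have quad: "0 \<le> 2 * t * c + t\<^sup>2 * e" for t
  proof -
    have "(norm (M *v (u + t *\<^sub>R w)))\<^sup>2 - s\<^sup>2 * (norm (u + t *\<^sub>R w))\<^sup>2 = 2 * t * c + t\<^sup>2 * e"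
      unfolding power2_norm_eq_inner c_def e_def
      using min2
      by (simp add: matrix_vector_right_distrib matrix_vector_mult_scaleR inner_add_left
          inner_add_right inner_commute algebra_simps power2_eq_square)
    then show ?thesis using nonneg[of "u + t *\<^sub>R w"] by simp
  qed
  \<comment> \<open>Along the line through \<open>u\<close> in direction \<open>w\<close> the form is \<open>2 t c + t\<^sup>2 e\<close>; the step \<open>t = - c / (1 + e)\<close> makes it negative unless \<open>c = 0\<close>, also when \<open>e = 0\<close>.\<close>
  have "2 * (- c / (1 + e)) * c + (- c / (1 + e))\<^sup>2 * e = - (c\<^sup>2 * (2 + e)) / (1 + e)\<^sup>2"
    using e by (simp add: field_simps power2_eq_square add_nonneg_eq_0_iff)
  with quad[of "- c / (1 + e)"] have "0 \<le> - (c\<^sup>2 * (2 + e)) / (1 + e)\<^sup>2" by simp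
  then have "c\<^sup>2 * (2 + e) \<le> 0" using e by (simp add: field_simps zero_le_divide_iff)
  then have "c = 0" using e by (simp add: mult_le_0_iff)
  then show ?thesis by (simp add: c_def)
qed

text \<open>
  Eigenvectors of the symmetric matrix \<open>A\<^sup>T A\<close> for different eigenvalues are orthogonal, and a family
  of nonzero orthogonal vectors is finite. Without finiteness, the \<open>Min\<close> that defines the smallest
  singular value would be unspecified.
\<close>

lemma finite_singular_values: "finite (singular_values (A :: real^'n^'m))"
proof -
  have "\<forall>s\<in>singular_values A. \<exists>v. v \<noteq> 0 \<and> (transpose A ** A) *v v = s\<^sup>2 *\<^sub>R v"
    by (auto simp: singular_values_def)
  then obtain f where f: "\<And>s. s \<in> singular_values A \<Longrightarrow> f s \<noteq> 0"
    "\<And>s. s \<in> singular_values A \<Longrightarrow> (transpose A ** A) *v f s = s\<^sup>2 *\<^sub>R f s"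
    by metis
  have nonneg: "0 \<le> s" if "s \<in> singular_values A" for s
    using that by (simp add: singular_values_def)
  have inj: "inj_on f (singular_values A)"
  proof (rule inj_onI)
    fix s t assume *: "s \<in> singular_values A" "t \<in> singular_values A" "f s = f t"
    then have "s\<^sup>2 *\<^sub>R f s = t\<^sup>2 *\<^sub>R f s" using f(2)[of s] f(2)[of t] by metis
    then have "s\<^sup>2 = t\<^sup>2" using f(1)[OF *(1)] by simp
    then show "s = t" using nonneg[OF *(1)] nonneg[OF *(2)] by (simp add: power2_eq_iff_nonneg)
  qed
  have "pairwise orthogonal (f ` singular_values A)"
  proof (intro pairwise_imageI)
    fix s t assume *: "s \<in> singular_values A" "t \<in> singular_values A" "s \<noteq> t"
    have gram: "((transpose A ** A) *v y) \<bullet> z = (A *v y) \<bullet> (A *v z)" for y z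
      by (simp add: inner_transpose_matrix_vector matrix_vector_mul_assoc[symmetric])
    have "s\<^sup>2 * (f s \<bullet> f t) = t\<^sup>2 * (f s \<bullet> f t)"
      using gram[of "f s" "f t"] gram[of "f t" "f s"] f(2)[OF *(1)] f(2)[OF *(2)]
      by (simp add: inner_commute)
    moreover have "s\<^sup>2 \<noteq> t\<^sup>2"
      using *(3) nonneg[OF *(1)] nonneg[OF *(2)] by (simp add: power2_eq_iff_nonneg)
    ultimately show "orthogonal (f s) (f t)" by (simp add: orthogonal_def)
  qed
  then have "finite (f ` singular_values A)" by (rule pairwise_orthogonal_imp_finite)
  then show ?thesis using inj by (rule finite_imageD)
qed

text \<open>
  A minimizer \<open>u\<close> of \<open>\<parallel>A v\<parallel>\<close> on the unit sphere exists by compactness and is an eigenvector of \<open>A\<^sup>T A\<close>,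
  so the minimal stretch is a singular value; every other singular value is the stretch of its own
  eigenvector and hence not smaller.
\<close>

proposition smallest_singular_value_min_stretch:
  fixes A :: "real^'n^'m"
  shows smallest_singular_value_nonneg: "0 \<le> smallest_singular_value A"
    and smallest_singular_value_le: "smallest_singular_value A * norm v \<le> norm (A *v v)"
    and smallest_singular_value_attained:
      "\<exists>u. norm u = 1 \<and> norm (A *v u) = smallest_singular_value A"
proof -
  have "compact (sphere 0 1 :: (real^'n) set)" by simp
  moreover have "sphere 0 1 \<noteq> ({} :: (real^'n) set)" by simp
  moreover have "continuous_on (sphere 0 1) (\<lambda>v. norm (A *v v))"
    by (intro continuous_intros linear_continuous_on matrix_vector_mul_bounded_linear)
  ultimately obtain u where u: "norm u = 1" "\<And>v. norm v = 1 \<Longrightarrow> norm (A *v u) \<le> norm (A *v v)"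
    using continuous_attains_inf[of "sphere 0 1" "\<lambda>v. norm (A *v v)"] by auto
  define s where "s = norm (A *v u)"
  have lower: "s * norm v \<le> norm (A *v v)" for v
  proof (cases "v = 0")
    case False
    have "s \<le> norm (A *v (v /\<^sub>R norm v))" unfolding s_def by (rule u(2)) (simp add: False)
    also have "\<dots> = norm (A *v v) / norm v"
      by (simp add: matrix_vector_mult_scaleR divide_inverse)
    finally show ?thesis using False by (simp add: field_simps)
  qed simp
  have min: "norm (A *v u) = s * norm u" using u(1) by (simp add: s_def)
  have "(transpose A ** A) *v u = s\<^sup>2 *\<^sub>R u"
  proof -
    have "((transpose A ** A) *v u) \<bullet> w = (s\<^sup>2 *\<^sub>R u) \<bullet> w" for w
      using inner_eq_if_minimal_stretch[OF lower _ min, of w]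
      by (simp add: s_def inner_transpose_matrix_vector matrix_vector_mul_assoc[symmetric])
    then show ?thesis using vector_eq_rdot by blast
  qed
  moreover have "u \<noteq> 0" using u(1) by auto
  ultimately have mem: "s \<in> singular_values A" unfolding singular_values_def s_def by auto
  have "s \<le> t" if "t \<in> singular_values A" for t
  proof -
    from that obtain v where t: "0 \<le> t" "v \<noteq> 0" "(transpose A ** A) *v v = t\<^sup>2 *\<^sub>R v"
      by (auto simp: singular_values_def)
    have "(norm (A *v v))\<^sup>2 = ((transpose A ** A) *v v) \<bullet> v"
      by (simp add: inner_transpose_matrix_vector matrix_vector_mul_assoc[symmetric]
          power2_norm_eq_inner)
    also have "\<dots> = (t * norm v)\<^sup>2" by (simp add: t(3) power_mult_distrib power2_norm_eq_inner)
    finally have "norm (A *v v) = t * norm v" using t(1) by (simp add: power2_eq_iff_nonneg)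
    then show ?thesis using lower[of v] t(2) by simp
  qed
  then have eq: "smallest_singular_value A = s"
    unfolding smallest_singular_value_def
    by (intro Min_eqI finite_singular_values mem)
  show "0 \<le> smallest_singular_value A" by (simp add: eq s_def)
  show "smallest_singular_value A * norm v \<le> norm (A *v v)" by (simp add: eq lower)
  show "\<exists>u. norm u = 1 \<and> norm (A *v u) = smallest_singular_value A" using u(1) by (auto simp: eq s_def)
qed

text \<open>
  A Lipschitz bound with constant 1: test the minimality of the one matrix on a minimizer of the other.
\<close>

lemma smallest_singular_value_le_add_norm:
  fixes A A' :: "real^'n^'m"
  shows "smallest_singular_value A' \<le> smallest_singular_value A + norm (A' - A)"
proof -
  obtain u where u: "norm u = 1" "norm (A *v u) = smallest_singular_value A"
    using smallest_singular_value_attained[of A] by blast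
  have "smallest_singular_value A' \<le> norm (A' *v u)"
    using smallest_singular_value_le[of A' u] u(1) by simp
  also have "\<dots> = norm (A *v u + (A' - A) *v u)" by (simp add: matrix_vector_mult_diff_rdistrib)
  also have "\<dots> \<le> smallest_singular_value A + norm (A' - A)"
    using norm_triangle_ineq[of "A *v u" "(A' - A) *v u"] norm_matrix_vector_le[of "A' - A" u] u
    by simp
  finally show ?thesis .
qed

lemma isCont_smallest_singular_value: "isCont smallest_singular_value (A :: real^'n^'m)"
proof -
  have "norm (smallest_singular_value A' - smallest_singular_value A) \<le> norm (A' - A)"
    for A' :: "real^'n^'m"
    using smallest_singular_value_le_add_norm[of A' A] smallest_singular_value_le_add_norm[of A A']
    by (simp add: abs_le_iff norm_minus_commute)
  then have "\<forall>\<^sub>F A' in at A. norm (smallest_singular_value A' - smallest_singular_value A) \<le> norm (A' - A)"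
    by (rule always_eventually[rule_format])
  moreover have "((\<lambda>A'. norm (A' - A)) \<longlongrightarrow> 0) (at A)"
    by (auto intro!: tendsto_eq_intros)
  ultimately have "((\<lambda>A'. smallest_singular_value A' - smallest_singular_value A) \<longlongrightarrow> 0) (at A)"
    by (rule Lim_null_comparison)
  then show ?thesis unfolding isCont_def by (rule LIM_zero_cancel)
qed

section \<open>Total least squares solutions as minimizers of the stretch\<close>

text \<open>
  The vectors on which augmented matrices act, in block form \<open>(y, c)\<close>.
\<close>

definition append_coord :: "real^'n \<Rightarrow> real \<Rightarrow> real^('n + 1)" where
  "append_coord y c = (\<chi> j. case j of Inl i \<Rightarrow> y $ i | Inr _ \<Rightarrow> c)"

lemma sum_augmented_index:
  fixes f :: "'n::finite + 1 \<Rightarrow> real"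
  shows "(\<Sum>j\<in>UNIV. f j) = (\<Sum>i\<in>UNIV. f (Inl i)) + f (Inr 1)"
proof -
  have "(\<Sum>j\<in>UNIV. f j) = (\<Sum>j\<in>UNIV <+> UNIV. f j)" by (simp only: UNIV_Plus_UNIV)
  also have "\<dots> = (\<Sum>i\<in>UNIV. f (Inl i)) + (\<Sum>i\<in>(UNIV :: 1 set). f (Inr i))"
    by (subst sum.Plus) auto
  also have "(UNIV :: 1 set) = {1}" by auto
  finally show ?thesis by simp
qed

lemma inner_append_coord: "append_coord y c \<bullet> append_coord z d = y \<bullet> z + c * d"
  by (simp add: inner_vec_def sum_augmented_index append_coord_def)

lemma augment_mult_append_coord:
  "augment A b *v append_coord y c = A *v y + c *\<^sub>R b"
  by (simp add: vec_eq_iff matrix_vector_mult_def sum_augmented_index append_coord_def augment_def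
      mult.commute)

lemma append_coord_surj: "\<exists>y c. w = append_coord y c"
proof -
  have "w = append_coord (\<chi> i. w $ Inl i) (w $ Inr 1)"
    by (simp add: vec_eq_iff append_coord_def split: sum.split)
  then show ?thesis by blast
qed

lemma augment_surj: "\<exists>A b. M = augment A b"
proof -
  have "M = augment (\<chi> i j. M $ i $ Inl j) (\<chi> i. M $ i $ Inr 1)"
    by (simp add: vec_eq_iff augment_def split: sum.split)
  then show ?thesis by blast
qed

lemma outer_mult_vector: "outer x y *v z = (y \<bullet> z) *\<^sub>R x"
  by (simp add: vec_eq_iff matrix_vector_mult_def outer_def inner_vec_def sum_distrib_left
      sum_distrib_right mult_ac)

lemma norm_outer: "norm (outer x y) = norm x * norm y"
proof -
  have "outer x y $ i = (x $ i) *\<^sub>R y" for i by (simp add: vec_eq_iff outer_def)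
  then show ?thesis
    by (simp add: norm_vec_def[of "outer x y"] norm_vec_def[of x] L2_set_left_distrib)
qed

text \<open>
  The vector \<open>(x, -1)\<close> attains the minimal stretch of \<open>[A, b]\<close>. In the generic case this
  characterizes the TLS solution without reference to corrected matrices.
\<close>

definition tls_residual_minimal :: "real^'n^'m \<Rightarrow> real^'m \<Rightarrow> real^'n \<Rightarrow> bool" where
  "tls_residual_minimal A b x \<longleftrightarrow>
     norm (augment A b *v append_coord x (-1)) =
       smallest_singular_value (augment A b) * norm (append_coord x (-1))"

lemma append_coord_minus_one_nonzero: "append_coord x (-1) \<noteq> 0"
proof -
  have "append_coord x (-1) \<bullet> append_coord x (-1) > 0"
    by (simp add: inner_append_coord add_nonneg_pos)
  then show ?thesis by auto
qed

lemma augment_kernel_iff: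
  "augment A b *v append_coord x (-1) = 0 \<longleftrightarrow> A *v x = b"
  by (simp add: augment_mult_append_coord)

text \<open>
  A feasible \<open>C' = [A', b']\<close> annihilates some \<open>z = (y, -1)\<close>, so \<open>C z = (C - C') z\<close>, and the Frobenius
  norm of \<open>C - C'\<close> bounds its stretch at \<open>z\<close>.
\<close>

lemma smallest_singular_value_le_correction:
  assumes "b' \<in> range (\<lambda>y. A' *v y)"
  shows "smallest_singular_value (augment A b) \<le> norm (augment A b - augment A' b')"
proof -
  obtain y where y: "augment A' b' *v append_coord y (-1) = 0"
    using assms by (auto simp: augment_kernel_iff)
  define z where "z = append_coord y (-1)"
  have "smallest_singular_value (augment A b) * norm z \<le> norm (augment A b *v z)"
    by (rule smallest_singular_value_le)
  also have "augment A b *v z = (augment A b - augment A' b') *v z"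
    using y by (simp add: z_def matrix_vector_mult_diff_rdistrib)
  also have "norm \<dots> \<le> norm (augment A b - augment A' b') * norm z"
    by (rule norm_matrix_vector_le)
  finally show ?thesis
    using append_coord_minus_one_nonzero[of y] by (simp add: z_def)
qed

text \<open>
  Subtracting the rank-one matrix \<open>C z z\<^sup>T / \<parallel>z\<parallel>\<^sup>2\<close> from \<open>C\<close> makes it vanish at \<open>z = (x, -1)\<close>; its
  Frobenius norm is \<open>\<parallel>C z\<parallel> / \<parallel>z\<parallel>\<close>, the lower bound that holds for all feasible corrections.
\<close>

lemma optimal_correction_exists:
  assumes "tls_residual_minimal A b x"
  obtains A' b' where "A' *v x = b'"
    "norm (augment A b - augment A' b') = smallest_singular_value (augment A b)"
proof -
  define C where "C = augment A b"
  define z where "z = append_coord x (-1)"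
  have z: "z \<noteq> 0" unfolding z_def by (rule append_coord_minus_one_nonzero)
  define D where "D = outer (C *v z) ((1 / (norm z)\<^sup>2) *\<^sub>R z)"
  obtain A' b' where AB: "C - D = augment A' b'" using augment_surj by blast
  have "D *v z = C *v z"
    using z by (simp add: D_def outer_mult_vector power2_norm_eq_inner)
  then have "augment A' b' *v z = 0" by (simp add: AB[symmetric] matrix_vector_mult_diff_rdistrib)
  then have "A' *v x = b'" by (simp add: z_def augment_kernel_iff)
  moreover have "norm (C - augment A' b') = smallest_singular_value C"
  proof -
    have "norm D = norm (C *v z) / norm z"
      using z by (simp add: D_def norm_outer power2_eq_square)
    also have "norm (C *v z) = smallest_singular_value C * norm z"
      using assms by (simp add: tls_residual_minimal_def C_def z_def)
    finally show ?thesis using z by (simp add: AB[symmetric])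
  qed
  ultimately show thesis unfolding C_def by (rule that)
qed

lemma is_tls_solution_if_minimal:
  assumes "tls_residual_minimal A b x"
  shows "is_tls_solution A b x"
proof -
  obtain A' b' where *: "A' *v x = b'"
    "norm (augment A b - augment A' b') = smallest_singular_value (augment A b)"
    using optimal_correction_exists[OF assms] .
  then have "tls_minimizer A b A' b'"
    unfolding tls_minimizer_def using smallest_singular_value_le_correction by fastforce
  then show ?thesis using *(1) unfolding is_tls_solution_def by blast
qed

text \<open>
  Through \<open>x0\<close> the smallest singular value is attained as the cost of a feasible correction. Every
  optimal correction then costs exactly this, and it bounds the stretch at \<open>(x, -1)\<close>.
\<close>

lemma minimal_if_is_tls_solution:
  assumes x0: "tls_residual_minimal A b x0" and x: "is_tls_solution A b x"
  shows "tls_residual_minimal A b x"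
proof -
  obtain A' b' where min: "tls_minimizer A b A' b'" and feas: "A' *v x = b'"
    using x unfolding is_tls_solution_def by blast
  obtain A0 b0 where A0: "A0 *v x0 = b0"
    "norm (augment A b - augment A0 b0) = smallest_singular_value (augment A b)"
    using optimal_correction_exists[OF x0] .
  define z where "z = append_coord x (-1)"
  have "norm (augment A b - augment A' b') \<le> smallest_singular_value (augment A b)"
    using min A0 unfolding tls_minimizer_def by (metis rangeI)
  then have le: "norm (augment A b - augment A' b') * norm z
      \<le> smallest_singular_value (augment A b) * norm z"
    by (rule mult_right_mono) simp
  have "augment A b *v z = (augment A b - augment A' b') *v z"
    using feas by (simp add: augment_kernel_iff matrix_vector_mult_diff_rdistrib z_def)
  then have "norm (augment A b *v z) \<le> norm (augment A b - augment A' b') * norm z"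
    using norm_matrix_vector_le by metis
  then show ?thesis
    using le smallest_singular_value_le[of "augment A b" z]
    unfolding tls_residual_minimal_def z_def by linarith
qed

text \<open>
  If a minimizing vector \<open>(w, c)\<close> had \<open>c = 0\<close>, then \<open>A\<close> would stretch \<open>w\<close> by no more than the smallest
  singular value of \<open>[A, b]\<close>, contrary to genericity. Otherwise it can be scaled to last entry \<open>-1\<close>.
\<close>

lemma tls_residual_minimal_exists:
  assumes "tls_generic A b"
  shows "\<exists>x. tls_residual_minimal A b x"
proof -
  let ?C = "augment A b"
  obtain u where u: "norm u = 1" "norm (?C *v u) = smallest_singular_value ?C"
    using smallest_singular_value_attained by blast
  obtain w c where wc: "u = append_coord w c" using append_coord_surj by blast
  have "c \<noteq> 0"
  proof
    assume c: "c = 0"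
    have "(norm u)\<^sup>2 = (norm w)\<^sup>2" by (simp add: wc c power2_norm_eq_inner inner_append_coord)
    then have "norm w = 1" using u(1) power2_eq_iff_nonneg[of "norm u" "norm w"] by simp
    then have "smallest_singular_value A \<le> smallest_singular_value ?C"
      using smallest_singular_value_le[of A w] u(2) by (simp add: wc c augment_mult_append_coord)
    then show False using assms by (simp add: tls_generic_def)
  qed
  define k where "k = - 1 / c"
  have "append_coord (k *\<^sub>R w) (-1) = k *\<^sub>R u"
    using \<open>c \<noteq> 0\<close> by (simp add: vec_eq_iff append_coord_def wc k_def split: sum.split)
  then have "tls_residual_minimal A b (k *\<^sub>R w)"
    using u by (simp add: tls_residual_minimal_def matrix_vector_mult_scaleR)
  then show ?thesis ..
qed

text \<open>
  Stationarity of the stretch at \<open>(x, -1)\<close>, tested against \<open>(h, c)\<close>. The choice \<open>c = 0\<close> gives the normal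
  equation, and \<open>(h, c) = (x, -1)\<close> gives back the minimal value.
\<close>

lemma tls_residual_minimal_inner:
  assumes "tls_residual_minimal A b x"
  shows "(A *v x - b) \<bullet> (A *v h + c *\<^sub>R b)
    = (smallest_singular_value (augment A b))\<^sup>2 * (x \<bullet> h - c)"
proof -
  have "(augment A b *v append_coord x (-1)) \<bullet> (augment A b *v append_coord h c) =
    (smallest_singular_value (augment A b))\<^sup>2 * (append_coord x (-1) \<bullet> append_coord h c)"
    by (rule inner_eq_if_minimal_stretch)
      (use assms smallest_singular_value_le smallest_singular_value_nonneg in
        \<open>auto simp: tls_residual_minimal_def\<close>)
  then show ?thesis by (simp add: augment_mult_append_coord inner_append_coord)
qed

lemma tls_normal_equation:
  assumes "tls_residual_minimal A b x"
  shows "transpose A *v (b - A *v x) + (smallest_singular_value (augment A b))\<^sup>2 *\<^sub>R x = 0"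
proof -
  have "(transpose A *v (b - A *v x) + (smallest_singular_value (augment A b))\<^sup>2 *\<^sub>R x) \<bullet> h = 0 \<bullet> h"
    for h
    using tls_residual_minimal_inner[OF assms, of h 0]
    by (simp add: inner_add_left inner_transpose_matrix_vector inner_diff_left)
  then show ?thesis using vector_eq_rdot by blast
qed

lemma tls_residual_value:
  assumes "tls_residual_minimal A b x"
  shows "(norm (b - A *v x))\<^sup>2 / (1 + x \<bullet> x) = (smallest_singular_value (augment A b))\<^sup>2"
proof -
  have "(A *v x - b) \<bullet> (A *v x - b) = (smallest_singular_value (augment A b))\<^sup>2 * (1 + x \<bullet> x)"
    using tls_residual_minimal_inner[OF assms, of x "-1"] by (simp add: add.commute)
  moreover have "1 + x \<bullet> x > 0" by (simp add: add_pos_nonneg)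
  ultimately show ?thesis
    by (simp add: power2_norm_eq_inner[symmetric] norm_minus_commute field_simps)
qed

text \<open>
  The difference of two solutions is a direction \<open>(x - y, 0)\<close> that again has minimal stretch, which
  genericity excludes as in the existence proof.
\<close>

lemma tls_residual_minimal_unique:
  assumes "tls_generic A b" "tls_residual_minimal A b x" "tls_residual_minimal A b y"
  shows "x = y"
proof (rule ccontr)
  assume "x \<noteq> y"
  define s where "s = smallest_singular_value (augment A b)"
  define t where "t = smallest_singular_value A"
  have st: "s < t" "0 \<le> s" using assms(1) smallest_singular_value_nonneg
    by (auto simp: tls_generic_def s_def t_def)
  have "(A *v x - b) \<bullet> (A *v (x - y)) = s\<^sup>2 * (x \<bullet> (x - y))"
    "(A *v y - b) \<bullet> (A *v (x - y)) = s\<^sup>2 * (y \<bullet> (x - y))"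
    using tls_residual_minimal_inner[OF assms(2), of "x - y" 0]
      tls_residual_minimal_inner[OF assms(3), of "x - y" 0] by (auto simp: s_def)
  then have "(A *v (x - y)) \<bullet> (A *v (x - y)) = s\<^sup>2 * ((x - y) \<bullet> (x - y))"
    by (simp add: matrix_vector_mult_diff_distrib inner_diff_left algebra_simps)
  then have "(norm (A *v (x - y)))\<^sup>2 = (s * norm (x - y))\<^sup>2"
    by (simp add: power2_norm_eq_inner power_mult_distrib)
  then have "norm (A *v (x - y)) = s * norm (x - y)" using st by (simp add: power2_eq_iff_nonneg)
  moreover have "t * norm (x - y) \<le> norm (A *v (x - y))"
    unfolding t_def by (rule smallest_singular_value_le)
  ultimately show False using st \<open>x \<noteq> y\<close> by simp
qed

proposition tls_solution_minimal:
  assumes "tls_generic A b"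
  shows "tls_residual_minimal A b (tls_solution A b)"
proof -
  obtain x where x: "tls_residual_minimal A b x" using tls_residual_minimal_exists[OF assms] ..
  have "tls_solution A b = x"
    unfolding tls_solution_def
    using is_tls_solution_if_minimal[OF x] minimal_if_is_tls_solution[OF x]
      tls_residual_minimal_unique[OF assms _ x]
    by (intro the_equality) auto
  then show ?thesis using x by simp
qed

section \<open>Implicit differentiation and continuity of the solution\<close>

text \<open>
  Implicit differentiation at a single point, for a solution \<open>g\<close> of \<open>G (e, g e) = 0\<close> that is already known
  to be continuous. The map \<open>Q\<close> is a left inverse of the partial derivative of \<open>G\<close> in the second variable. Applying \<open>Q\<close> to the
  first-order expansion of \<open>G\<close> gives \<open>g e - g d + T (e - d) = o(\<parallel>e - d\<parallel> + \<parallel>g e - g d\<parallel>)\<close> with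
  \<open>T u = Q (G' (u, 0))\<close>; this estimate first shows \<open>g e - g d = O(\<parallel>e - d\<parallel>)\<close>, and then the claim.
\<close>

lemma has_derivative_implicit:
  fixes G :: "'a::real_normed_vector \<times> 'b::real_normed_vector \<Rightarrow> 'c::real_normed_vector"
    and g :: "'a \<Rightarrow> 'b"
  assumes G: "(G has_derivative G') (at (d, g d))"
    and Q: "bounded_linear Q" "\<And>w. Q (G' (0, w)) = w"
    and cont: "isCont g d"
    and zero: "\<forall>\<^sub>F e in nhds d. G (e, g e) = 0"
  shows "(g has_derivative (\<lambda>u. - Q (G' (u, 0)))) (at d)"
proof -
  have G'_lin: "bounded_linear G'" using G by (rule has_derivative_bounded_linear)
  define T where "T = (\<lambda>u. Q (G' (u, 0)))"
  have T: "bounded_linear T"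
    unfolding T_def
    by (intro bounded_linear_compose[OF Q(1)] bounded_linear_compose[OF G'_lin]
        bounded_linear_Pair bounded_linear_ident bounded_linear_zero)
  obtain K where K: "K \<ge> 0" "\<And>u. norm (T u) \<le> norm u * K"
    using bounded_linear.nonneg_bounded[OF T] by blast
  have split: "Q (G' (u, w)) = T u + w" for u w
  proof -
    have "G' (u, w) = G' (u, 0) + G' (0, w)"
      using linear_add[OF bounded_linear.linear[OF G'_lin], of "(u, 0)" "(0, w)"] by simp
    then show ?thesis
      using linear_add[OF bounded_linear.linear[OF Q(1)]] Q(2) by (simp add: T_def)
  qed
  have QG: "((\<lambda>p. Q (G p)) has_derivative (\<lambda>p. Q (G' p))) (at (d, g d))"
    by (rule bounded_linear.has_derivative[OF Q(1) G])
  have zero_d: "G (d, g d) = 0" using zero by (rule eventually_nhds_x_imp_x)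
  have Q0: "Q 0 = 0" by (rule linear_0[OF bounded_linear.linear[OF Q(1)]])
  have lim: "((\<lambda>e. (e, g e)) \<longlongrightarrow> (d, g d)) (at d)"
    using cont by (intro tendsto_Pair tendsto_ident_at) (simp add: isCont_def)
  have estimate: "\<forall>\<^sub>F e in at d. norm (g e - g d + T (e - d)) \<le> \<epsilon> * (norm (e - d) + norm (g e - g d))"
    if "\<epsilon> > 0" for \<epsilon>
  proof -
    obtain \<delta> where \<delta>: "\<delta> > 0" "\<And>p. norm (p - (d, g d)) < \<delta> \<Longrightarrow>
        norm (Q (G p) - Q (G (d, g d)) - Q (G' (p - (d, g d)))) \<le> \<epsilon> * norm (p - (d, g d))"
      using QG \<open>\<epsilon> > 0\<close> unfolding has_derivative_at_alt by metis
    have "\<forall>\<^sub>F e in at d. norm ((e, g e) - (d, g d)) < \<delta>"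
      using lim \<open>\<delta> > 0\<close> by (simp add: tendsto_iff dist_norm)
    moreover have "\<forall>\<^sub>F e in at d. G (e, g e) = 0"
      using zero by (simp add: eventually_nhds_conv_at)
    ultimately show ?thesis
    proof eventually_elim
      case (elim e)
      have "norm (g e - g d + T (e - d)) = norm (- (T (e - d) + (g e - g d)))"
        by (simp only: norm_minus_cancel add.commute)
      also have "\<dots> = norm (Q (G (e, g e)) - Q (G (d, g d)) - Q (G' ((e, g e) - (d, g d))))"
        by (simp add: elim(2) zero_d Q0 split)
      also have "\<dots> \<le> \<epsilon> * norm ((e, g e) - (d, g d))"
        using \<delta>(2) elim(1) by blast
      also have "\<dots> \<le> \<epsilon> * (norm (e - d) + norm (g e - g d))"
        using \<open>\<epsilon> > 0\<close> norm_Pair_le[of "e - d" "g e - g d"] by simp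
      finally show ?case .
    qed
  qed
  have "\<forall>\<^sub>F e in at d. norm (g e - g d - - T (e - d)) \<le> \<epsilon> * norm (e - d)" if "\<epsilon> > 0" for \<epsilon>
  proof -
    \<comment> \<open>The bound \<open>1/2\<close> lets the increment of \<open>g\<close> be absorbed into the left-hand side, which leaves \<open>(2 K + 2) \<parallel>e - d\<parallel>\<close> for both increments together.\<close>
    define \<eta> where "\<eta> = min (1/2) (\<epsilon> / (2 * K + 2))"
    have K2: "2 * K + 2 > 0" using K(1) by simp
    have "\<eta> \<le> \<epsilon> / (2 * K + 2)" unfolding \<eta>_def by (rule min.cobounded2)
    then have \<eta>3: "\<eta> * (2 * K + 2) \<le> \<epsilon>" using K2 by (simp only: pos_le_divide_eq)
    have \<eta>1: "\<eta> > 0" unfolding \<eta>_def using \<open>\<epsilon> > 0\<close> K2 by simp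
    have \<eta>2: "\<eta> \<le> 1/2" unfolding \<eta>_def by (rule min.cobounded1)
    show ?thesis
      using estimate[OF \<eta>1]
    proof eventually_elim
      case (elim e)
      let ?u = "norm (e - d)" and ?w = "norm (g e - g d)"
      have "?w = norm ((g e - g d + T (e - d)) - T (e - d))" by simp
      also have "\<dots> \<le> norm (g e - g d + T (e - d)) + norm (T (e - d))"
        by (rule norm_triangle_ineq4)
      also have "\<dots> \<le> \<eta> * (?u + ?w) + K * ?u"
        using elim K(2)[of "e - d"] by (simp add: mult.commute)
      also have "\<dots> \<le> 1/2 * (?u + ?w) + K * ?u"
        using \<eta>2 by (intro add_right_mono mult_right_mono) auto
      finally have w: "?u + ?w \<le> (2 * K + 2) * ?u" by (simp add: algebra_simps)
      have "norm (g e - g d + T (e - d)) \<le> \<eta> * ((2 * K + 2) * ?u)"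
        using elim mult_left_mono[OF w, of \<eta>] \<eta>1 by linarith
      also have "\<dots> \<le> \<epsilon> * ?u"
        using mult_right_mono[OF \<eta>3, of ?u] by (simp add: mult.assoc)
      finally show ?case by simp
    qed
  qed
  moreover have "bounded_linear (\<lambda>u. - T u)" using T by (rule bounded_linear_minus)
  ultimately have "(g has_derivative (\<lambda>u. - T u)) (at d)"
    unfolding has_derivative_within_alt2[where s = UNIV] by simp
  then show ?thesis by (simp add: T_def)
qed

lemma bounded_bilinear_matrix_vector_mult:
  "bounded_bilinear (\<lambda>(A :: real^'n^'m) x. A *v x)"
proof
  show "\<exists>K. \<forall>(A :: real^'n^'m) x. norm (A *v x) \<le> norm A * norm x * K"
    using norm_matrix_vector_le by (intro exI[of _ 1]) auto
qed (auto simp: matrix_vector_mult_add_rdistrib matrix_vector_right_distrib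
    matrix_vector_mult_scaleR scaleR_matrix_vector_assoc)

lemma bounded_linear_transpose: "bounded_linear (transpose :: real^'n^'m \<Rightarrow> real^'m^'n)"
  by (simp add: linear_conv_bounded_linear[symmetric])
    (auto intro!: linearI simp: transpose_def vec_eq_iff)

lemma bounded_linear_augment:
  "bounded_linear (\<lambda>p :: (real^'n^'m) \<times> (real^'m). augment (fst p) (snd p))"
  by (simp add: linear_conv_bounded_linear[symmetric])
    (auto intro!: linearI simp: augment_def vec_eq_iff split: sum.split)

lemmas isCont_matrix_vector_mult = bounded_bilinear.isCont[OF bounded_bilinear_matrix_vector_mult]
lemmas isCont_transpose = bounded_linear.isCont[OF bounded_linear_transpose]

text \<open>
  Subtracting the normal equation of the solution \<open>x\<close> shows that the residual of \<open>y\<close> in it equals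
  \<open>P (x - y)\<close>, where \<open>P = A\<^sup>T A - \<sigma>\<^sup>2 I\<close> satisfies \<open>w \<bullet> P w \<ge> (\<tau>\<^sup>2 - \<sigma>\<^sup>2) \<parallel>w\<parallel>\<^sup>2\<close>, with \<open>\<tau>\<close> the smallest
  singular value of \<open>A\<close>. The point \<open>y\<close> is arbitrary: continuity of the solution uses the
  solution of the unperturbed problem as an approximate solution of the perturbed one.
\<close>

lemma tls_error_bound:
  assumes "tls_generic A b"
  shows "norm (tls_solution A b - y) \<le>
    norm (transpose A *v (b - A *v y) + (smallest_singular_value (augment A b))\<^sup>2 *\<^sub>R y) /
      ((smallest_singular_value A)\<^sup>2 - (smallest_singular_value (augment A b))\<^sup>2)"
proof -
  define s where "s = smallest_singular_value (augment A b)"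
  define t where "t = smallest_singular_value A"
  define x where "x = tls_solution A b"
  define R where "R = transpose A *v (b - A *v y) + s\<^sup>2 *\<^sub>R y"
  have gap: "t\<^sup>2 - s\<^sup>2 > 0"
    using assms smallest_singular_value_nonneg[of "augment A b"]
    by (simp add: tls_generic_def s_def t_def power_strict_mono)
  have "transpose A *v (b - A *v x) + s\<^sup>2 *\<^sub>R x = 0"
    unfolding s_def x_def by (rule tls_normal_equation[OF tls_solution_minimal[OF assms]])
  then have R: "R = transpose A *v (A *v (x - y)) - s\<^sup>2 *\<^sub>R (x - y)"
    by (simp add: R_def matrix_vector_mult_diff_distrib algebra_simps)
  have "(t * norm (x - y))\<^sup>2 \<le> (norm (A *v (x - y)))\<^sup>2"
    unfolding t_def by (intro power_mono smallest_singular_value_le)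
      (simp add: smallest_singular_value_nonneg)
  then have "(t\<^sup>2 - s\<^sup>2) * (norm (x - y))\<^sup>2 \<le> (norm (A *v (x - y)))\<^sup>2 - s\<^sup>2 * (norm (x - y))\<^sup>2"
    by (simp add: algebra_simps power_mult_distrib)
  also have "\<dots> = R \<bullet> (x - y)"
    by (simp add: R inner_diff_left[of "transpose A *v (A *v (x - y))"]
        inner_transpose_matrix_vector power2_norm_eq_inner)
  also have "\<dots> \<le> norm R * norm (x - y)" by (rule norm_cauchy_schwarz)
  finally have "(t\<^sup>2 - s\<^sup>2) * norm (x - y) \<le> norm R"
    by (cases "x = y") (simp_all add: power2_eq_square flip: mult.assoc)
  then have "norm (x - y) \<le> norm R / (t\<^sup>2 - s\<^sup>2)" using gap by (simp add: field_simps)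
  then show ?thesis by (simp add: x_def R_def s_def t_def)
qed

lemma isCont_smallest_singular_value_augment:
  "isCont (\<lambda>p. smallest_singular_value (augment (fst p) (snd p))) (p :: (real^'n^'m) \<times> (real^'m))"
  by (rule isCont_o2[OF linear_continuous_at[OF bounded_linear_augment]
        isCont_smallest_singular_value])

lemma isCont_smallest_singular_value_fst:
  "isCont (\<lambda>p. smallest_singular_value (fst p)) (p :: (real^'n^'m) \<times> (real^'m))"
  by (rule isCont_o2[OF _ isCont_smallest_singular_value]) (intro continuous_intros)

lemma eventually_tls_generic:
  assumes "tls_generic A b"
  shows "\<forall>\<^sub>F p in nhds (A, b). tls_generic (fst p) (snd p)"
proof -
  have "((\<lambda>p. smallest_singular_value (fst p) - smallest_singular_value (augment (fst p) (snd p)))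
      \<longlongrightarrow> smallest_singular_value A - smallest_singular_value (augment A b)) (at (A, b))"
    using isCont_diff[OF isCont_smallest_singular_value_fst isCont_smallest_singular_value_augment,
        of "(A, b)"] by (simp add: isCont_def)
  then have "\<forall>\<^sub>F p in at (A, b).
      smallest_singular_value (fst p) - smallest_singular_value (augment (fst p) (snd p)) > 0"
    using assms by (intro order_tendstoD) (auto simp: tls_generic_def)
  then show ?thesis
    using assms by (simp add: eventually_nhds_conv_at tls_generic_def)
qed

text \<open>
  By the error bound, the distance from the solution \<open>x\<close> of the unperturbed problem to that of a nearby
  one is at most the residual of \<open>x\<close> in the perturbed normal equation divided by the perturbed gap. The
  quotient depends continuously on the data and vanishes at \<open>(A, b)\<close>.
\<close>

lemma isCont_tls_solution:
  assumes "tls_generic A b"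
  shows "isCont (\<lambda>p. tls_solution (fst p) (snd p)) (A, b)"
proof -
  define x where "x = tls_solution A b"
  define s where "s = (\<lambda>p :: (real^'a^'b) \<times> (real^'b). smallest_singular_value (augment (fst p) (snd p)))"
  define t where "t = (\<lambda>p :: (real^'a^'b) \<times> (real^'b). smallest_singular_value (fst p))"
  define R where "R = (\<lambda>p. transpose (fst p) *v (snd p - fst p *v x) + (s p)\<^sup>2 *\<^sub>R x)"
  have gap: "(t (A, b))\<^sup>2 - (s (A, b))\<^sup>2 > 0"
    using assms smallest_singular_value_nonneg[of "augment A b"]
    by (simp add: tls_generic_def s_def t_def power_strict_mono)
  have conts: "isCont s (A, b)" "isCont t (A, b)"
    unfolding s_def t_def
    by (rule isCont_smallest_singular_value_augment isCont_smallest_singular_value_fst)+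
  have "isCont R (A, b)"
    unfolding R_def
    by (intro continuous_intros isCont_matrix_vector_mult isCont_transpose conts)
  then have "isCont (\<lambda>p. norm (R p) / ((t p)\<^sup>2 - (s p)\<^sup>2)) (A, b)"
    using gap by (intro continuous_intros conts) auto
  moreover have "R (A, b) = 0"
    using tls_normal_equation[OF tls_solution_minimal[OF assms]] by (simp add: R_def s_def x_def)
  ultimately have "((\<lambda>p. norm (R p) / ((t p)\<^sup>2 - (s p)\<^sup>2)) \<longlongrightarrow> 0) (at (A, b))"
    by (simp add: isCont_def)
  moreover have "\<forall>\<^sub>F p in at (A, b).
      norm (tls_solution (fst p) (snd p) - x) \<le> norm (R p) / ((t p)\<^sup>2 - (s p)\<^sup>2)"
    using eventually_tls_generic[OF assms]
    unfolding eventually_nhds_conv_at R_def s_def t_def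
    by (auto elim!: eventually_mono intro: tls_error_bound)
  ultimately have "((\<lambda>p. tls_solution (fst p) (snd p) - x) \<longlongrightarrow> 0) (at (A, b))"
    by (rule Lim_null_comparison[rotated])
  then show ?thesis unfolding isCont_def x_def by (simp add: LIM_zero_iff)
qed

section \<open>The derivative of the solution\<close>

text \<open>
  The left-hand side of the normal equation, with \<open>\<sigma>\<^sup>2\<close> replaced by \<open>\<parallel>b - A x\<parallel>\<^sup>2 / (1 + x\<^sup>T x)\<close>. Both have
  the same value at a solution, but this expression is differentiable in all variables by the usual
  rules, whereas the derivative of a singular value would need perturbation theory.
\<close>

definition tls_equation :: "((real^'n^'m) \<times> (real^'m)) \<times> (real^'n) \<Rightarrow> real^'n" where
  "tls_equation p =
     (let \<rho> = snd (fst p) - fst (fst p) *v snd p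
      in transpose (fst (fst p)) *v \<rho> + ((\<rho> \<bullet> \<rho>) / (1 + snd p \<bullet> snd p)) *\<^sub>R snd p)"

lemma tls_equation_tls_solution:
  assumes "tls_generic A b"
  shows "tls_equation ((A, b), tls_solution A b) = 0"
  using tls_normal_equation[OF tls_solution_minimal[OF assms]]
    tls_residual_value[OF tls_solution_minimal[OF assms]]
  by (simp add: tls_equation_def Let_def power2_norm_eq_inner)

lemmas has_derivative_matrix_vector_mult =
  bounded_bilinear.FDERIV[OF bounded_bilinear_matrix_vector_mult]
lemmas has_derivative_transpose = bounded_linear.has_derivative[OF bounded_linear_transpose]

text \<open>
  The scalar factor \<open>\<mu> = \<parallel>r\<parallel>\<^sup>2 / (1 + x\<^sup>T x)\<close> has gradient \<open>- 2 (A\<^sup>T r + \<mu> x) / (1 + x\<^sup>T x)\<close> in \<open>x\<close>, which is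
  zero at a solution of the normal equation. So \<open>x\<close> contributes to the derivative only through
  \<open>- A\<^sup>T A + \<mu> I\<close>, while the change of \<open>\<mu>\<close> with the data produces the rank-one term.
\<close>

lemma has_derivative_tls_equation:
  fixes A :: "real^'n^'m" and b :: "real^'m" and x :: "real^'n"
  defines "r \<equiv> b - A *v x"
  defines "\<mu> \<equiv> (r \<bullet> r) / (1 + x \<bullet> x)"
  assumes normal: "transpose A *v r + \<mu> *\<^sub>R x = 0"
  shows "(tls_equation has_derivative (\<lambda>p.
      transpose (fst (fst p)) *v r
      + (transpose A + (2 / (1 + x \<bullet> x)) *\<^sub>R outer x r) *v (snd (fst p) - fst (fst p) *v x)
      - (transpose A ** A - \<mu> *\<^sub>R mat 1) *v snd p)) (at ((A, b), x))"
proof -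
  define q where "q = 1 + x \<bullet> x"
  have q: "q > 0" by (simp add: q_def add_pos_nonneg)
  define \<rho> where "\<rho> = (\<lambda>p :: ((real^'n^'m) \<times> (real^'m)) \<times> (real^'n). snd (fst p) - fst (fst p) *v snd p)"
  define \<rho>' where "\<rho>' = (\<lambda>p :: ((real^'n^'m) \<times> (real^'m)) \<times> (real^'n). snd (fst p) - (A *v snd p + fst (fst p) *v x))"
  have d\<rho>: "(\<rho> has_derivative \<rho>') (at ((A, b), x))"
    unfolding \<rho>_def \<rho>'_def
    by (rule derivative_eq_intros has_derivative_matrix_vector_mult | simp)+
  have \<rho>_at: "\<rho> ((A, b), x) = r" by (simp add: \<rho>_def r_def)
  have d\<mu>: "((\<lambda>p. (\<rho> p \<bullet> \<rho> p) / (1 + snd p \<bullet> snd p)) has_derivative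
      (\<lambda>p. (2 * (r \<bullet> \<rho>' p) * q - (r \<bullet> r) * (2 * (x \<bullet> snd p))) / (q * q))) (at ((A, b), x))"
  proof -
    have 1: "((\<lambda>p. \<rho> p \<bullet> \<rho> p) has_derivative (\<lambda>p. 2 * (r \<bullet> \<rho>' p))) (at ((A, b), x))"
      by (rule has_derivative_eq_rhs[OF has_derivative_inner[OF d\<rho> d\<rho>]])
        (simp add: \<rho>_at inner_commute fun_eq_iff)
    have 2: "((\<lambda>p. 1 + snd p \<bullet> snd p) has_derivative (\<lambda>p. 2 * (x \<bullet> snd p))) (at ((A, b), x))"
      by (auto intro!: derivative_eq_intros simp: inner_commute)
    show ?thesis
      by (rule has_derivative_eq_rhs[OF has_derivative_divide'[OF 1 2]])
        (use q in \<open>auto simp: \<rho>_at q_def\<close>)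
  qed
  have "(tls_equation has_derivative (\<lambda>p.
      transpose A *v \<rho>' p + transpose (fst (fst p)) *v r
      + (((r \<bullet> r) / q) *\<^sub>R snd p
         + ((2 * (r \<bullet> \<rho>' p) * q - (r \<bullet> r) * (2 * (x \<bullet> snd p))) / (q * q)) *\<^sub>R x)))
      (at ((A, b), x))"
  proof -
    have dA: "((\<lambda>p :: ((real^'n^'m) \<times> (real^'m)) \<times> (real^'n). transpose (fst (fst p))) has_derivative
        (\<lambda>p. transpose (fst (fst p)))) (at ((A, b), x))"
      by (intro has_derivative_transpose derivative_intros)
    have dx: "((\<lambda>p :: ((real^'n^'m) \<times> (real^'m)) \<times> (real^'n). snd p) has_derivative snd) (at ((A, b), x))"
      by (intro derivative_intros)
    have eq: "tls_equation = (\<lambda>p. transpose (fst (fst p)) *v \<rho> p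
        + ((\<rho> p \<bullet> \<rho> p) / (1 + snd p \<bullet> snd p)) *\<^sub>R snd p)"
      by (simp add: tls_equation_def Let_def \<rho>_def fun_eq_iff)
    show ?thesis
      unfolding eq
      by (rule has_derivative_eq_rhs[OF has_derivative_add[OF
              has_derivative_matrix_vector_mult[OF dA d\<rho>] has_derivative_scaleR[OF d\<mu> dx]]])
        (simp add: \<rho>_at q_def fun_eq_iff)
  qed
  moreover have "transpose A *v \<rho>' p + transpose (fst (fst p)) *v r
      + (((r \<bullet> r) / q) *\<^sub>R snd p
         + ((2 * (r \<bullet> \<rho>' p) * q - (r \<bullet> r) * (2 * (x \<bullet> snd p))) / (q * q)) *\<^sub>R x)
    = transpose (fst (fst p)) *v r
      + (transpose A + (2 / q) *\<^sub>R outer x r) *v (snd (fst p) - fst (fst p) *v x)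
      - (transpose A ** A - \<mu> *\<^sub>R mat 1) *v snd p" for p
  proof -
    define e where "e = snd (fst p) - fst (fst p) *v x"
    define h where "h = snd p"
    have \<rho>': "\<rho>' p = e - A *v h" by (simp add: \<rho>'_def e_def h_def)
    have \<mu>: "\<mu> = (r \<bullet> r) / q" by (simp add: \<mu>_def q_def)
    have "(transpose A *v r) \<bullet> h = - \<mu> * (x \<bullet> h)"
      using normal by (simp add: add_eq_0_iff2)
    then have crit: "r \<bullet> (A *v h) = - \<mu> * (x \<bullet> h)" by (simp add: inner_transpose_matrix_vector)
    \<comment> \<open>The contributions of the increment \<open>h\<close> of \<open>x\<close> to the change of \<open>\<mu>\<close> cancel by \<open>crit\<close>.\<close>
    have coeff: "(2 * (r \<bullet> \<rho>' p) * q - (r \<bullet> r) * (2 * (x \<bullet> h))) / (q * q) = 2 / q * (r \<bullet> e)"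
      using q by (simp add: \<rho>' inner_diff_right crit \<mu> field_simps)
    show ?thesis
      unfolding h_def[symmetric] e_def[symmetric] coeff
      by (simp add: \<rho>' \<mu> matrix_vector_mult_diff_distrib matrix_vector_mult_diff_rdistrib
          matrix_vector_mult_add_rdistrib outer_mult_vector matrix_vector_mul_assoc
          scaleR_matrix_vector_assoc[symmetric] algebra_simps)
  qed
  ultimately show ?thesis unfolding q_def by (simp only:)
qed

text \<open>
  A kernel vector of \<open>P\<close> would be stretched by \<open>A\<close> exactly by the smallest singular value of \<open>[A, b]\<close>,
  which is below the minimal stretch of \<open>A\<close>.
\<close>

lemma tls_matrix_inverse:
  fixes A :: "real^'n^'m"
  assumes "tls_generic A b"
    and P: "P = transpose A ** A - (smallest_singular_value (augment A b))\<^sup>2 *\<^sub>R mat 1"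
  shows "matrix_inv P ** P = mat 1"
proof -
  define s where "s = smallest_singular_value (augment A b)"
  define t where "t = smallest_singular_value A"
  have st: "s < t" "0 \<le> s" using assms(1) smallest_singular_value_nonneg
    by (auto simp: tls_generic_def s_def t_def)
  have "w = 0" if "P *v w = 0" for w
  proof (rule ccontr)
    assume "w \<noteq> 0"
    have "(A *v w) \<bullet> (A *v w) = (transpose A *v (A *v w)) \<bullet> w"
      by (simp add: inner_transpose_matrix_vector)
    also have "transpose A *v (A *v w) = s\<^sup>2 *\<^sub>R w"
      using that by (simp add: P s_def matrix_vector_mult_diff_rdistrib matrix_vector_mul_assoc
          scaleR_matrix_vector_assoc[symmetric])
    finally have "(norm (A *v w))\<^sup>2 = (s * norm w)\<^sup>2"
      by (simp add: power2_norm_eq_inner power_mult_distrib)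
    then have "norm (A *v w) = s * norm w" using st by (simp add: power2_eq_iff_nonneg)
    moreover have "t * norm w \<le> norm (A *v w)" unfolding t_def by (rule smallest_singular_value_le)
    ultimately show False using st \<open>w \<noteq> 0\<close> by simp
  qed
  then have "invertible P"
    by (simp add: invertible_left_inverse matrix_left_invertible_ker)
  then show ?thesis unfolding invertible_def matrix_inv_def by (rule someI2_ex) simp
qed

proposition has_derivative_tls_solution:
  fixes A :: "real^'n^'m"
  assumes generic: "tls_generic A b"
    and x: "x = tls_solution A b"
    and r: "r = b - A *v x"
    and P: "P = transpose A ** A - (smallest_singular_value (augment A b))\<^sup>2 *\<^sub>R mat 1"
    and B: "B = transpose A + (2 / (1 + x \<bullet> x)) *\<^sub>R outer x r"
  shows "((\<lambda>p. tls_solution (fst p) (snd p)) has_derivative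
      (\<lambda>p. matrix_inv P *v (transpose (fst p) *v r + B *v (snd p - fst p *v x)))) (at (A, b))"
proof -
  have min: "tls_residual_minimal A b x" unfolding x by (rule tls_solution_minimal[OF generic])
  have \<mu>: "(r \<bullet> r) / (1 + x \<bullet> x) = (smallest_singular_value (augment A b))\<^sup>2"
    using tls_residual_value[OF min] by (simp add: r power2_norm_eq_inner)
  define G' where "G' = (\<lambda>p :: ((real^'n^'m) \<times> (real^'m)) \<times> (real^'n).
      transpose (fst (fst p)) *v r + B *v (snd (fst p) - fst (fst p) *v x) - P *v snd p)"
  have "(tls_equation has_derivative G') (at ((A, b), x))"
    using has_derivative_tls_equation[of A b x] tls_normal_equation[OF min]
    by (simp add: r[symmetric] \<mu> P[symmetric] B[symmetric] G'_def)
  then have G: "(tls_equation has_derivative G') (at ((A, b), tls_solution (fst (A, b)) (snd (A, b))))"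
    by (simp add: x)
  define Q where "Q = (\<lambda>y. - (matrix_inv P *v y))"
  have Q_lin: "bounded_linear Q"
    unfolding Q_def by (intro bounded_linear_minus matrix_vector_mul_bounded_linear)
  have transpose_0: "transpose (0 :: real^'n^'m) = 0" by (simp add: transpose_def vec_eq_iff)
  \<comment> \<open>The partial derivative in \<open>x\<close> is \<open>- P\<close>, hence the sign in \<open>Q\<close>.\<close>
  have Q_inv: "Q (G' (0, w)) = w" for w
    using tls_matrix_inverse[OF generic P]
    by (simp add: Q_def G'_def transpose_0 vec.neg matrix_vector_mul_assoc)
  have "\<forall>\<^sub>F p in nhds (A, b). tls_equation (p, tls_solution (fst p) (snd p)) = 0"
    using eventually_tls_generic[OF generic]
    by eventually_elim (metis prod.collapse tls_equation_tls_solution)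
  from has_derivative_implicit[OF G Q_lin Q_inv isCont_tls_solution[OF generic] this]
  show ?thesis by (simp add: Q_def G'_def)
qed

section \<open>Maximizing a linear map over componentwise perturbations\<close>

lemma abs_vec_nth: "\<bar>v :: real^'n\<bar> $ i = \<bar>v $ i\<bar>"
  by (simp add: abs_vec_def)

lemma abs_matrix_nth: "\<bar>M :: real^'n^'m\<bar> $ i $ j = \<bar>M $ i $ j\<bar>"
  by (simp add: abs_vec_def)

text \<open>
  The \<open>LEAST\<close> in the norm is an infimum of a closed set of reals, so it is admissible itself.
\<close>

lemma componentwise_norm_eq_1D:
  assumes "componentwise_norm (a, b) (da, db) = 1"
  shows "\<bar>da\<bar> \<le> \<bar>a\<bar>" "\<bar>db\<bar> \<le> \<bar>b\<bar>"
proof -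
  define W where "W = {\<omega>::real. 0 \<le> \<omega> \<and> \<bar>da\<bar> \<le> \<omega> *\<^sub>R \<bar>a\<bar> \<and> \<bar>db\<bar> \<le> \<omega> *\<^sub>R \<bar>b\<bar>}"
  have nonempty: "\<exists>\<omega>\<ge>0. \<bar>da\<bar> \<le> \<omega> *\<^sub>R \<bar>a\<bar> \<and> \<bar>db\<bar> \<le> \<omega> *\<^sub>R \<bar>b\<bar>"
    using assms by (auto simp: componentwise_norm_def split: if_splits)
  have "closed W"
    unfolding W_def less_eq_vec_def
    by (intro closed_Collect_conj closed_Collect_all closed_Collect_le continuous_intros)
  moreover have "W \<noteq> {}" using nonempty by (auto simp: W_def)
  moreover have bdd: "bdd_below W" by (rule bdd_belowI[of _ 0]) (simp add: W_def)
  ultimately have "Inf W \<in> W" by (intro closed_contains_Inf)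
  then have "(LEAST \<omega>. \<omega> \<in> W) = Inf W"
    by (rule Least_equality) (simp add: cInf_lower bdd)
  moreover have "(LEAST \<omega>. \<omega> \<in> W) = 1"
    using assms nonempty by (simp add: componentwise_norm_def W_def one_ereal_def)
  ultimately have "1 \<in> W" using \<open>Inf W \<in> W\<close> by simp
  then show "\<bar>da\<bar> \<le> \<bar>a\<bar>" "\<bar>db\<bar> \<le> \<bar>b\<bar>" by (simp_all add: W_def)
qed

text \<open>
  A nonzero entry of \<open>a\<close> prevents any \<open>\<omega> < 1\<close> from being admissible. For zero data the norm would
  be 0.
\<close>

lemma componentwise_norm_eq_1I:
  assumes "\<bar>da\<bar> = \<bar>a\<bar>" "\<bar>db\<bar> = \<bar>b\<bar>" "a \<noteq> 0"
  shows "componentwise_norm (a, b) (da, db) = 1"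
proof -
  obtain i where i: "a $ i \<noteq> 0" using \<open>a \<noteq> 0\<close> by (auto simp: vec_eq_iff)
  have "(LEAST \<omega>::real. \<omega> \<ge> 0 \<and> \<bar>da\<bar> \<le> \<omega> *\<^sub>R \<bar>a\<bar> \<and> \<bar>db\<bar> \<le> \<omega> *\<^sub>R \<bar>b\<bar>) = 1"
  proof (rule Least_equality)
    show "1 \<ge> (0::real) \<and> \<bar>da\<bar> \<le> 1 *\<^sub>R \<bar>a\<bar> \<and> \<bar>db\<bar> \<le> 1 *\<^sub>R \<bar>b\<bar>" using assms by simp
  next
    fix \<omega> :: real assume "\<omega> \<ge> 0 \<and> \<bar>da\<bar> \<le> \<omega> *\<^sub>R \<bar>a\<bar> \<and> \<bar>db\<bar> \<le> \<omega> *\<^sub>R \<bar>b\<bar>"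
    then have "\<bar>a\<bar> $ i \<le> (\<omega> *\<^sub>R \<bar>a\<bar>) $ i" using assms(1) by (simp add: less_eq_vec_def)
    then show "1 \<le> \<omega>" using i by (simp add: abs_vec_nth)
  qed
  moreover have "\<exists>\<omega>\<ge>0::real. \<bar>da\<bar> \<le> \<omega> *\<^sub>R \<bar>a\<bar> \<and> \<bar>db\<bar> \<le> \<omega> *\<^sub>R \<bar>b\<bar>"
    using assms by (intro exI[of _ 1]) simp
  ultimately show ?thesis by (simp add: componentwise_norm_def one_ereal_def)
qed

lemma infnorm_le_cart:
  fixes x :: "real^'n"
  assumes "\<And>i. \<bar>x $ i\<bar> \<le> c"
  shows "infnorm x \<le> c"
  unfolding infnorm_cart by (rule cSup_least) (use assms in auto)

lemma ex_infnorm_le_component: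
  fixes y :: "real^'n"
  shows "\<exists>i. infnorm y \<le> \<bar>y $ i\<bar>"
proof -
  have "Max (range (\<lambda>i. \<bar>y $ i\<bar>)) \<in> range (\<lambda>i. \<bar>y $ i\<bar>)" by (rule Max_in) auto
  then obtain i where "Max (range (\<lambda>i. \<bar>y $ i\<bar>)) = \<bar>y $ i\<bar>" by blast
  then have "\<bar>y $ j\<bar> \<le> \<bar>y $ i\<bar>" for j by (metis Max_ge finite finite_imageI rangeI)
  then show ?thesis using infnorm_le_cart by blast
qed

lemma abs_matrix_vector_le:
  fixes K :: "real^'q^'k"
  assumes "\<bar>u\<bar> \<le> \<bar>a\<bar>"
  shows "\<bar>(K *v u) $ i\<bar> \<le> (\<bar>K\<bar> *v \<bar>a\<bar>) $ i"
proof -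
  have "\<bar>u $ j\<bar> \<le> \<bar>a $ j\<bar>" for j using assms by (simp add: less_eq_vec_def abs_vec_nth)
  then have "(\<Sum>j\<in>UNIV. \<bar>K $ i $ j * u $ j\<bar>) \<le> (\<Sum>j\<in>UNIV. \<bar>K $ i $ j\<bar> * \<bar>a $ j\<bar>)"
    by (intro sum_mono) (simp add: abs_mult mult_left_mono)
  then have "\<bar>\<Sum>j\<in>UNIV. K $ i $ j * u $ j\<bar> \<le> (\<Sum>j\<in>UNIV. \<bar>K $ i $ j\<bar> * \<bar>a $ j\<bar>)"
    by (rule order_trans[OF sum_abs])
  then show ?thesis by (simp add: matrix_vector_mult_def abs_matrix_nth abs_vec_nth)
qed

lemma abs_matrix_vector_attained:
  fixes K :: "real^'q^'k"
  shows "\<exists>u. \<bar>u\<bar> = \<bar>a\<bar> \<and> (K *v u) $ i = (\<bar>K\<bar> *v \<bar>a\<bar>) $ i"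
proof -
  define u where "u = (\<chi> j. if K $ i $ j \<ge> 0 then \<bar>a $ j\<bar> else - \<bar>a $ j\<bar>)"
  have "\<bar>u\<bar> = \<bar>a\<bar>" by (simp add: vec_eq_iff abs_vec_nth u_def)
  moreover have "K $ i $ j * u $ j = \<bar>K $ i $ j\<bar> * \<bar>a $ j\<bar>" for j by (simp add: u_def)
  then have "(K *v u) $ i = (\<bar>K\<bar> *v \<bar>a\<bar>) $ i"
    by (simp add: matrix_vector_mult_def abs_matrix_nth abs_vec_nth)
  ultimately show ?thesis by blast
qed

text \<open>
  The sign pattern of a perturbation can be adapted to one row of \<open>K\<^sub>1\<close> and \<open>K\<^sub>2\<close> only. For the
  infinity norm one row is enough: the row in which the bound is largest.
\<close>

proposition greatest_infnorm_componentwise: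
  fixes K\<^sub>1 :: "real^'q^'k" and K\<^sub>2 :: "real^'m^'k"
  assumes "a \<noteq> 0"
  shows "(GREATEST c. \<exists>h. componentwise_norm (a, b) h = 1 \<and>
      c = infnorm (K\<^sub>1 *v fst h + K\<^sub>2 *v snd h)) = infnorm (\<bar>K\<^sub>1\<bar> *v \<bar>a\<bar> + \<bar>K\<^sub>2\<bar> *v \<bar>b\<bar>)"
proof -
  define y where "y = \<bar>K\<^sub>1\<bar> *v \<bar>a\<bar> + \<bar>K\<^sub>2\<bar> *v \<bar>b\<bar>"
  have upper: "infnorm (K\<^sub>1 *v fst h + K\<^sub>2 *v snd h) \<le> infnorm y"
    if "componentwise_norm (a, b) h = 1" for h
  proof (rule infnorm_le_cart)
    fix i
    have "\<bar>fst h\<bar> \<le> \<bar>a\<bar>" "\<bar>snd h\<bar> \<le> \<bar>b\<bar>"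
      using componentwise_norm_eq_1D[of a b "fst h" "snd h"] that by auto
    then have "\<bar>(K\<^sub>1 *v fst h + K\<^sub>2 *v snd h) $ i\<bar> \<le> y $ i"
      using abs_matrix_vector_le[of "fst h" a K\<^sub>1 i] abs_matrix_vector_le[of "snd h" b K\<^sub>2 i]
      by (simp add: y_def)
    also have "\<dots> \<le> infnorm y" using component_le_infnorm_cart[of y i] by simp
    finally show "\<bar>(K\<^sub>1 *v fst h + K\<^sub>2 *v snd h) $ i\<bar> \<le> infnorm y" .
  qed
  obtain i where i: "infnorm y \<le> \<bar>y $ i\<bar>" using ex_infnorm_le_component by blast
  obtain da where da: "\<bar>da\<bar> = \<bar>a\<bar>" "(K\<^sub>1 *v da) $ i = (\<bar>K\<^sub>1\<bar> *v \<bar>a\<bar>) $ i"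
    using abs_matrix_vector_attained by blast
  obtain db where db: "\<bar>db\<bar> = \<bar>b\<bar>" "(K\<^sub>2 *v db) $ i = (\<bar>K\<^sub>2\<bar> *v \<bar>b\<bar>) $ i"
    using abs_matrix_vector_attained by blast
  have norm: "componentwise_norm (a, b) (da, db) = 1"
    by (rule componentwise_norm_eq_1I[OF da(1) db(1) assms])
  have "y $ i = (K\<^sub>1 *v da + K\<^sub>2 *v db) $ i" by (simp add: y_def da db)
  then have "infnorm y \<le> infnorm (K\<^sub>1 *v da + K\<^sub>2 *v db)"
    using i component_le_infnorm_cart[of "K\<^sub>1 *v da + K\<^sub>2 *v db" i] by simp
  then have attained: "infnorm y = infnorm (K\<^sub>1 *v da + K\<^sub>2 *v db)"
    using upper[OF norm] by simp
  have "(GREATEST c. \<exists>h. componentwise_norm (a, b) h = 1 \<and>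
      c = infnorm (K\<^sub>1 *v fst h + K\<^sub>2 *v snd h)) = infnorm y"
    by (rule Greatest_equality) (use attained norm upper in force)+
  then show ?thesis by (simp add: y_def)
qed

section \<open>The structured condition number\<close>

lemma linear_struct_matrix: "linear (struct_matrix S)"
  by (rule linearI)
    (simp_all add: struct_matrix_def scaleR_add_left sum.distrib scaleR_sum_right)

lemma matrix_mult_column: "(M ** N) $ i $ j = (M *v (\<chi> k. N $ k $ j)) $ i"
  by (simp add: matrix_matrix_mult_def matrix_vector_mult_def)

text \<open>
  The derivative of \<open>tls_map\<close> is \<open>has_derivative_tls_solution\<close> composed with two linear maps, and the
  columns \<open>v i\<close> of \<open>V\<close> are the images of the basis matrices under the linear map
  \<open>M \<mapsto> M\<^sup>T r - B (M x)\<close>.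
\<close>

theorem corollary3p6:
  fixes \<S> :: "(real^'n^'m) set"
    and S :: "'q::finite \<Rightarrow> real^'n^'m"
    and A :: "real^'n^'m"
    and a :: "real^'q"
    and b r :: "real^'m"
    and x :: "real^'n"
    and L :: "real^'n^'k"
    and P :: "real^'n^'n"
    and B H :: "real^'m^'n"
    and v :: "'q \<Rightarrow> real^'n"
    and V N\<^sub>s :: "real^'q^'n"
  assumes dims: "CARD('m) > CARD('n)" "CARD('k) \<le> CARD('n)"
    and subspace: "subspace \<S>"
    and basis: "inj S" "independent (range S)" "span (range S) = \<S>"
    and A: "A = struct_matrix S a"
    and generic: "tls_generic A b"
    and x: "x = tls_solution A b"
    and r: "r = b - A *v x"
    and P: "P = transpose A ** A - (smallest_singular_value (augment A b))\<^sup>2 *\<^sub>R mat 1"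
    and B: "B = transpose A + (2 / (1 + x \<bullet> x)) *\<^sub>R outer x r"
    and v: "\<And>i. v i = transpose (S i) *v r - B *v (S i *v x)"
    and V: "V = (\<chi> j i. v i $ j)"
    and N\<^sub>s: "N\<^sub>s = matrix_inv P ** V"
    and H: "H = matrix_inv P ** B"
  shows "structured_cond infnorm S L (a, b) =
           infnorm (\<bar>L ** N\<^sub>s\<bar> *v \<bar>a\<bar> + \<bar>L ** H\<bar> *v \<bar>b\<bar>) \<and>
         (L *v x \<noteq> 0 \<longrightarrow>
           structured_cond_rel infnorm S L (a, b) =
             infnorm (\<bar>L ** N\<^sub>s\<bar> *v \<bar>a\<bar> + \<bar>L ** H\<bar> *v \<bar>b\<bar>) / infnorm (L *v x) \<and>
           infnorm (\<bar>L ** N\<^sub>s\<bar> *v \<bar>a\<bar> + \<bar>L ** H\<bar> *v \<bar>b\<bar>) / infnorm (L *v x) =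
             infnorm ((\<Sum>i\<in>UNIV. \<bar>a $ i\<bar> *\<^sub>R
                         \<bar>(L ** matrix_inv P) *v (B *v (S i *v x) - transpose (S i) *v r)\<bar>)
                      + \<bar>L ** matrix_inv P ** B\<bar> *v \<bar>b\<bar>) / infnorm (L *v x))"
proof -
  \<comment> \<open>For \<open>a = 0\<close> the matrix \<open>A\<close> and its singular values vanish, contrary to genericity.\<close>
  have "a \<noteq> 0"
  proof
    assume "a = 0"
    then have "A = 0" by (simp add: A struct_matrix_def)
    then have "smallest_singular_value A = 0"
      using smallest_singular_value_attained[of A] by auto
    then show False
      using generic smallest_singular_value_nonneg[of "augment A b"] by (simp add: tls_generic_def)
  qed
  have V_mult: "transpose (struct_matrix S da) *v r - B *v (struct_matrix S da *v x) = V *v da" for da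
  proof -
    define f where "f M = transpose M *v r - B *v (M *v x)" for M :: "real^'n^'m"
    have "linear f"
      unfolding f_def
      by (rule linearI) (simp_all add: linear_add[OF bounded_linear.linear[OF bounded_linear_transpose]]
          transpose_scalar matrix_vector_mult_add_rdistrib matrix_vector_right_distrib
          scaleR_matrix_vector_assoc[symmetric] matrix_vector_mult_scaleR algebra_simps)
    then have "f (struct_matrix S da) = (\<Sum>i\<in>UNIV. da $ i *\<^sub>R f (S i))"
      by (simp add: struct_matrix_def linear_sum linear_scale)
    also have "\<dots> = (\<Sum>i\<in>UNIV. da $ i *\<^sub>R v i)" by (simp add: v f_def)
    also have "\<dots> = V *v da"
      by (simp add: vec_eq_iff V matrix_vector_mult_def mult.commute)
    finally show ?thesis by (simp add: f_def)
  qed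
  define D where "D = (\<lambda>h. (L ** N\<^sub>s) *v fst h + (L ** H) *v snd h)"
  have deriv: "(tls_map S L has_derivative D) (at (a, b))"
  proof -
    have data: "((\<lambda>h. (struct_matrix S (fst h), snd h)) has_derivative
        (\<lambda>h. (struct_matrix S (fst h), snd h))) (at (a, b))"
      by (intro has_derivative_Pair has_derivative_snd has_derivative_ident
          bounded_linear.has_derivative[OF linear_struct_matrix[unfolded linear_conv_bounded_linear]]
          has_derivative_fst)
    have sol: "((\<lambda>p. tls_solution (fst p) (snd p)) has_derivative
        (\<lambda>p. matrix_inv P *v (transpose (fst p) *v r + B *v (snd p - fst p *v x))))
        (at (struct_matrix S (fst (a, b)), snd (a, b)))"
      using has_derivative_tls_solution[OF generic x r P B] by (simp add: A)
    have "((\<lambda>h. L *v tls_solution (struct_matrix S (fst h)) (snd h)) has_derivative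
        (\<lambda>h. L *v (matrix_inv P *v (transpose (struct_matrix S (fst h)) *v r
          + B *v (snd h - struct_matrix S (fst h) *v x))))) (at (a, b))"
      using bounded_linear.has_derivative[OF matrix_vector_mul_bounded_linear[of L]
          has_derivative_compose[OF data sol]] by simp
    moreover have "L *v (matrix_inv P *v (transpose (struct_matrix S (fst h)) *v r
          + B *v (snd h - struct_matrix S (fst h) *v x))) = D h" for h
    proof -
      have "transpose (struct_matrix S (fst h)) *v r + B *v (snd h - struct_matrix S (fst h) *v x)
          = V *v fst h + B *v snd h"
        by (simp add: V_mult[symmetric] matrix_vector_mult_diff_distrib)
      then show ?thesis
        by (simp add: D_def N\<^sub>s H matrix_vector_right_distrib matrix_vector_mul_assoc matrix_mul_assoc)
    qed
    ultimately show ?thesis by (simp add: tls_map_def case_prod_unfold)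
  qed
  have cond: "structured_cond infnorm S L (a, b) =
      infnorm (\<bar>L ** N\<^sub>s\<bar> *v \<bar>a\<bar> + \<bar>L ** H\<bar> *v \<bar>b\<bar>)"
    unfolding structured_cond_def frechet_derivative_at[OF deriv, symmetric] D_def
    by (rule greatest_infnorm_componentwise[OF \<open>a \<noteq> 0\<close>])
  have "componentwise_norm (a, b) (a, b) = 1"
    by (rule componentwise_norm_eq_1I) (simp_all add: \<open>a \<noteq> 0\<close>)
  then have rel: "structured_cond_rel infnorm S L (a, b) =
      infnorm (\<bar>L ** N\<^sub>s\<bar> *v \<bar>a\<bar> + \<bar>L ** H\<bar> *v \<bar>b\<bar>) / infnorm (L *v x)"
    by (simp add: structured_cond_rel_def cond tls_map_def A[symmetric] x[symmetric])
  have "\<bar>L ** N\<^sub>s\<bar> *v \<bar>a\<bar> = (\<Sum>i\<in>UNIV. \<bar>a $ i\<bar> *\<^sub>R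
      \<bar>(L ** matrix_inv P) *v (B *v (S i *v x) - transpose (S i) *v r)\<bar>)"
  proof -
    have entry: "(L ** N\<^sub>s) $ j $ i = ((L ** matrix_inv P) *v v i) $ j" for i j
      unfolding N\<^sub>s matrix_mul_assoc by (simp add: matrix_mult_column V)
    have neg: "B *v (S i *v x) - transpose (S i) *v r = - v i" for i by (simp add: v)
    show ?thesis
      unfolding neg
      by (simp add: vec_eq_iff abs_vec_nth matrix_vector_mult_def[of "\<bar>L ** N\<^sub>s\<bar>"] abs_matrix_nth
          entry vec.neg mult.commute)
  qed
  then show ?thesis
    using cond rel by (simp add: H matrix_mul_assoc)
qed

end
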